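(* Suppose that $\mathbb{E}(\|Z\|^2) < \infty$ and $\mu := \mathbb{E} Z \neq \mathbf{0}$, and let $\hat\mu := \mu/\|\mu\|$. Then, as $n\to\infty$, \[ n^{-1/2}\left| D_n - S_n\cdot\hat\mu \right| \to 0, \quad \text{in } L^2. \]
   Context: Let $Z, Z_1, Z_2, \ldots$ be i.i.d. random variables in $\mathbb{R}^2$, and let $S_0 := \mathbf{0}$ (the origin) and $S_n := \sum_{k=1}^n Z_k$ for $n \ge 1$. Let $D_n := \operatorname{diam}\{S_0, \ldots, S_n\} = \max_{0\le i,j\le n}\|S_j - S_i\|$. Here $\|\cdot\|$ is the Euclidean norm. *)

theory Defs
  imports "HOL-Probability.Probability"
begin

text \<open>
  Generic copy \<open>Z\<close> and increments \<open>Zs 1, Zs 2, \<dots>\<close>: the value \<open>Zs 0\<close> is never used.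
\<close>

definition iid_increments ::
  "'a measure \<Rightarrow> ('a \<Rightarrow> real ^ 2) \<Rightarrow> (nat \<Rightarrow> 'a \<Rightarrow> real ^ 2) \<Rightarrow> bool" where
  "iid_increments M Z Zs \<longleftrightarrow>
     Z \<in> borel_measurable M \<and>
     prob_space.indep_vars M (\<lambda>_. borel) Zs {1..} \<and>
     (\<forall>k\<ge>1. distr M borel (Zs k) = distr M borel Z)"

definition walk :: "(nat \<Rightarrow> 'a \<Rightarrow> real ^ 2) \<Rightarrow> nat \<Rightarrow> 'a \<Rightarrow> real ^ 2" where
  "walk Zs n \<omega> = (\<Sum>k=1..n. Zs k \<omega>)"

definition walk_diam :: "(nat \<Rightarrow> 'a \<Rightarrow> real ^ 2) \<Rightarrow> nat \<Rightarrow> 'a \<Rightarrow> real" where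
  "walk_diam Zs n \<omega> = diameter ((\<lambda>k. walk Zs k \<omega>) ` {0..n})"

text \<open>
  Membership in \<open>L\<^sup>2\<close> is part of the definition, because the Bochner integral of a
  non-integrable function is \<open>0\<close>.
\<close>

definition converges_in_L2 ::
  "'a measure \<Rightarrow> (nat \<Rightarrow> 'a \<Rightarrow> real) \<Rightarrow> ('a \<Rightarrow> real) \<Rightarrow> bool" where
  "converges_in_L2 M X Y \<longleftrightarrow>
     (\<forall>n. X n \<in> borel_measurable M \<and> integrable M (\<lambda>\<omega>. (X n \<omega>)\<^sup>2)) \<and>
     Y \<in> borel_measurable M \<and> integrable M (\<lambda>\<omega>. (Y \<omega>)\<^sup>2) \<and>
     (\<lambda>n. \<integral>\<omega>. (X n \<omega> - Y \<omega>)\<^sup>2 \<partial>M) \<longlonglongrightarrow> 0"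

end

theory Submission
  imports Defs "HOL-Real_Asymp.Real_Asymp"
begin

text \<open>
  Write \<open>m\<close> for the norm of \<open>\<mu>\<close>, \<open>T k = walk k - k \<mu>\<close> for the centred walk and \<open>x\<close> for the
  difference of the diameter and \<open>walk n \<bullet> \<mu>_hat\<close>. It is nonnegative, because the diameter is at
  least the norm of \<open>walk n\<close>, so only an upper bound is at stake.

  That bound is deterministic. Let \<open>w\<close> be the largest deviation \<open>norm (T k)\<close> up to time \<open>n\<close>. Always
  \<open>x \<le> 3 w\<close>. If moreover \<open>w \<le> \<delta> n\<close> for a small \<open>\<delta>\<close>, then the path is a thin tube around a long
  segment. Its extension along \<open>\<mu>_hat\<close> can exceed \<open>walk n \<bullet> \<mu>_hat\<close> only by what the walk does in its
  first and its last \<open>2 \<delta> n / m\<close> steps, since at all other times the drift has carried it beyond its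
  starting point and not yet to its end point; and by Pythagoras the transversal deviation, of
  size at most \<open>2 w\<close>, adds only \<open>O(w\<^sup>2 / (m n)) = O(\<delta> w / m)\<close> to the length of a chord
  (lemma \<open>drift_diameter_le\<close>).

  A maximal inequality in \<open>L\<^sup>2\<close> bounds the expected squares of the maximal deviations over \<open>L\<close>
  steps by a multiple of \<open>L\<close>. Divided by \<open>n\<close>, the contributions of the first and last steps are
  thus \<open>O(\<delta>)\<close>, and so is the transversal one. What remains is the part of the expectation of
  \<open>w\<^sup>2 / n\<close> on the event \<open>w > \<delta> n\<close>, and it tends to \<open>0\<close> for each fixed \<open>\<delta>\<close>
  (lemma \<open>iid_tail_square_negligible\<close>): truncate the increments at level \<open>n powr (1/4)\<close>. The large
  parts contribute little by the maximal inequality, because their second moments vanish; the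
  bounded parts exceed a multiple of \<open>n\<close> only with a probability that decays faster than any power
  of \<open>n\<close>, by Hoeffding's inequality. Finally \<open>\<delta>\<close> is sent to \<open>0\<close>.
\<close>

section \<open>A maximal inequality along a path\<close>

text \<open>
  Doob's \<open>L\<^sup>2\<close> inequality before taking expectations: when \<open>s\<close> is a martingale, the sum has mean
  \<open>0\<close>, because each coefficient depends only on the past of the increment it multiplies.
\<close>

lemma running_max_square_le:
  fixes s :: "nat \<Rightarrow> real"
  assumes "s 0 = 0"
  shows "(MAX k\<in>{..n}. s k)\<^sup>2 + 4 * (\<Sum>j<n. (MAX k\<in>{..j}. s k) * (s (Suc j) - s j)) \<le> 4 * (s n)\<^sup>2"
proof -
  define m where "m j = (MAX k\<in>{..j}. s k)" for j
  have m_Suc: "m (Suc j) = max (s (Suc j)) (m j)" for j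
    by (simp add: m_def atMost_Suc)
  have "(m n)\<^sup>2 + 2 * (\<Sum>j<n. m j * (s (Suc j) - s j)) \<le> 2 * m n * s n"
  proof (induction n)
    case 0
    then show ?case using assms by (simp add: m_def)
  next
    case (Suc n)
    \<comment> \<open>If the maximum moves at all, it moves to the new value of the path.\<close>
    have "(m (Suc n))\<^sup>2 + 2 * m n * (s (Suc n) - s n) - (m n)\<^sup>2 \<le> 2 * m (Suc n) * s (Suc n) - 2 * m n * s n"
    proof (cases "s (Suc n) \<le> m n")
      case True
      then show ?thesis by (simp add: m_Suc algebra_simps)
    next
      case False
      have "0 \<le> (s (Suc n) - m n)\<^sup>2" by simp
      with False show ?thesis by (simp add: m_Suc power2_eq_square algebra_simps)
    qed
    with Suc show ?case by (simp add: algebra_simps)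
  qed
  moreover have "4 * m n * s n \<le> (m n)\<^sup>2 + 4 * (s n)\<^sup>2"
    using zero_le_power2[of "m n - 2 * s n"] by (simp add: power2_diff algebra_simps power_mult_distrib)
  ultimately show ?thesis unfolding m_def by linarith
qed

section \<open>Maxima of absolute partial sums\<close>

text \<open>
  The starting index \<open>p\<close> is a parameter because the bound on the diameter involves
  both the first and the last few steps of the walk.
\<close>

definition max_abs_sum :: "(nat \<Rightarrow> real) \<Rightarrow> nat \<Rightarrow> nat \<Rightarrow> real" where
  "max_abs_sum f p n = (MAX k\<in>{..n}. \<bar>sum f {p..<p+k}\<bar>)"

lemma abs_sum_le_max_abs_sum: "k \<le> n \<Longrightarrow> \<bar>sum f {p..<p+k}\<bar> \<le> max_abs_sum f p n"
  unfolding max_abs_sum_def by (rule Max_ge) auto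

lemma max_abs_sum_nonneg: "0 \<le> max_abs_sum f p n"
  using abs_sum_le_max_abs_sum[of 0 n f p] by simp

lemma max_abs_sum_leI: "(\<And>k. k \<le> n \<Longrightarrow> \<bar>sum f {p..<p+k}\<bar> \<le> B) \<Longrightarrow> max_abs_sum f p n \<le> B"
  unfolding max_abs_sum_def by (subst Max_le_iff) auto

lemma max_abs_sum_attained: "\<exists>k\<le>n. max_abs_sum f p n = \<bar>sum f {p..<p+k}\<bar>"
proof -
  have "max_abs_sum f p n \<in> (\<lambda>k. \<bar>sum f {p..<p+k}\<bar>) ` {..n}"
    unfolding max_abs_sum_def by (rule Max_in) auto
  then show ?thesis by auto
qed

lemma max_abs_sum_cong:
  "(\<And>i. p \<le> i \<Longrightarrow> i < p + n \<Longrightarrow> f i = g i) \<Longrightarrow> max_abs_sum f p n = max_abs_sum g p n"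
  unfolding max_abs_sum_def by (intro arg_cong[where f=Max] image_cong refl arg_cong[where f=abs] sum.cong) auto

lemma max_abs_sum_triangle:
  "max_abs_sum (\<lambda>i. f i + g i) p n \<le> max_abs_sum f p n + max_abs_sum g p n"
proof (rule max_abs_sum_leI)
  fix k assume "k \<le> n"
  then show "\<bar>\<Sum>i=p..<p+k. f i + g i\<bar> \<le> max_abs_sum f p n + max_abs_sum g p n"
    using abs_sum_le_max_abs_sum[of k n f p] abs_sum_le_max_abs_sum[of k n g p]
    by (simp add: sum.distrib)
qed

lemma max_abs_sum_measurable [measurable]:
  assumes "\<And>i. i \<in> {p..<p+n} \<Longrightarrow> f i \<in> borel_measurable M"
  shows "(\<lambda>\<omega>. max_abs_sum (\<lambda>i. f i \<omega>) p n) \<in> borel_measurable M"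
  unfolding max_abs_sum_def
  by (intro borel_measurable_Max borel_measurable_abs borel_measurable_sum assms) auto

lemma max_abs_sum_square_le:
  "(max_abs_sum f p n)\<^sup>2 \<le> (MAX k\<in>{..n}. sum f {p..<p+k})\<^sup>2 + (MAX k\<in>{..n}. sum (\<lambda>i. - f i) {p..<p+k})\<^sup>2"
proof -
  let ?M = "\<lambda>f. MAX k\<in>{..n}. sum f {p..<p+k}"
  obtain k where k: "k \<le> n" "max_abs_sum f p n = \<bar>sum f {p..<p+k}\<bar>"
    using max_abs_sum_attained by blast
  have le: "sum g {p..<p+k} \<le> ?M g" for g :: "nat \<Rightarrow> real"
    using k by (intro Max_ge) auto
  show ?thesis
  proof (cases "sum f {p..<p+k} \<ge> 0")
    case True
    then have "(max_abs_sum f p n)\<^sup>2 \<le> (?M f)\<^sup>2"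
      using le[of f] k by (intro power_mono) auto
    then show ?thesis by (smt (verit) zero_le_power2)
  next
    case False
    then have "(max_abs_sum f p n)\<^sup>2 \<le> (?M (\<lambda>i. - f i))\<^sup>2"
      using le[of "\<lambda>i. - f i"] k by (intro power_mono) (auto simp: sum_negf)
    then show ?thesis by (smt (verit) zero_le_power2)
  qed
qed

section \<open>The maximal inequality for independent centred increments\<close>

lemma integrable_square_add:
  fixes f g :: "'a \<Rightarrow> real"
  assumes [measurable]: "f \<in> borel_measurable M" "g \<in> borel_measurable M"
    and "integrable M (\<lambda>x. (f x)\<^sup>2)" "integrable M (\<lambda>x. (g x)\<^sup>2)"
  shows "integrable M (\<lambda>x. (f x + g x)\<^sup>2)"
proof (rule Bochner_Integration.integrable_bound)
  show "integrable M (\<lambda>x. 2 * (f x)\<^sup>2 + 2 * (g x)\<^sup>2)" using assms by simp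
  show "AE x in M. norm ((f x + g x)\<^sup>2) \<le> norm (2 * (f x)\<^sup>2 + 2 * (g x)\<^sup>2)"
  proof (rule AE_I2)
    fix x
    have "(f x + g x)\<^sup>2 \<le> 2 * (f x)\<^sup>2 + 2 * (g x)\<^sup>2"
      using sum_squares_bound[of "f x" "g x"] by (simp add: power2_sum)
    then show "norm ((f x + g x)\<^sup>2) \<le> norm (2 * (f x)\<^sup>2 + 2 * (g x)\<^sup>2)" by simp
  qed
qed simp

context prob_space begin

lemma centred_increment_uncorrelated_with_past:
  fixes X :: "'i \<Rightarrow> 'a \<Rightarrow> real"
  assumes ind: "indep_vars (\<lambda>_. borel) X I" and A: "A \<subseteq> I" and k: "k \<in> I" "k \<notin> A"
    and G: "G \<in> borel_measurable (PiM A (\<lambda>_. borel))"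
    and int_G: "integrable M (\<lambda>\<omega>. G (\<lambda>i\<in>A. X i \<omega>))"
    and X: "integrable M (X k)" "expectation (X k) = 0"
  shows "integrable M (\<lambda>\<omega>. G (\<lambda>i\<in>A. X i \<omega>) * X k \<omega>)"
    and "expectation (\<lambda>\<omega>. G (\<lambda>i\<in>A. X i \<omega>) * X k \<omega>) = 0"
proof -
  have "indep_var (PiM A (\<lambda>_. borel)) (\<lambda>\<omega>. \<lambda>i\<in>A. X i \<omega>)
                  (PiM {k} (\<lambda>_. borel)) (\<lambda>\<omega>. \<lambda>i\<in>{k}. X i \<omega>)"
    by (rule indep_var_restrict[OF ind]) (use A k in auto)
  from indep_var_compose[OF this G, of "\<lambda>f. f k" borel]
  have "indep_var borel (\<lambda>\<omega>. G (\<lambda>i\<in>A. X i \<omega>)) borel (X k)"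
    by (simp add: comp_def)
  note * = indep_var_integrable[OF this int_G X(1)] indep_var_lebesgue_integral[OF this int_G X(1)]
  show "integrable M (\<lambda>\<omega>. G (\<lambda>i\<in>A. X i \<omega>) * X k \<omega>)"
    and "expectation (\<lambda>\<omega>. G (\<lambda>i\<in>A. X i \<omega>) * X k \<omega>) = 0"
    using * X(2) by simp_all
qed

context
  fixes X :: "nat \<Rightarrow> 'a \<Rightarrow> real" and p n :: nat
  assumes indep: "indep_vars (\<lambda>_. borel) X {p..<p+n}"
    and square_int: "\<And>i. i \<in> {p..<p+n} \<Longrightarrow> integrable M (\<lambda>\<omega>. (X i \<omega>)\<^sup>2)"
    and centred: "\<And>i. i \<in> {p..<p+n} \<Longrightarrow> expectation (X i) = 0"
begin

lemma increment_measurable: "i \<in> {p..<p+n} \<Longrightarrow> X i \<in> borel_measurable M"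
  using indep by (auto simp: indep_vars_def)

lemma increment_integrable: "i \<in> {p..<p+n} \<Longrightarrow> integrable M (X i)"
  using square_integrable_imp_integrable[OF increment_measurable square_int] by blast

lemma partial_sum_measurable: "k \<le> n \<Longrightarrow> (\<lambda>\<omega>. \<Sum>i=p..<p+k. X i \<omega>) \<in> borel_measurable M"
  by (intro borel_measurable_sum increment_measurable) auto

lemma partial_sum_square_integrable:
  "k \<le> n \<Longrightarrow> integrable M (\<lambda>\<omega>. (\<Sum>i=p..<p+k. X i \<omega>)\<^sup>2)"
proof (induction k)
  case (Suc k)
  then have "p + k \<in> {p..<p+n}" by auto
  with Suc show ?case
    by (auto intro!: integrable_square_add partial_sum_measurable square_int increment_measurable)
qed simp

text \<open>
  A running maximum, signed or of absolute values, is up to sign one of finitely many partial sums,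
  so its square is dominated by the sum of all their squares.
\<close>

lemma partial_sum_max_square_integrable:
  assumes m: "m \<in> borel_measurable M" and att: "\<And>\<omega>. \<exists>k\<le>n. \<bar>m \<omega>\<bar> = \<bar>\<Sum>i=p..<p+k. X i \<omega>\<bar>"
  shows "integrable M (\<lambda>\<omega>. (m \<omega>)\<^sup>2)"
proof (rule Bochner_Integration.integrable_bound)
  show "integrable M (\<lambda>\<omega>. \<Sum>k\<le>n. (\<Sum>i=p..<p+k. X i \<omega>)\<^sup>2)"
    by (intro Bochner_Integration.integrable_sum partial_sum_square_integrable) auto
  have "(m \<omega>)\<^sup>2 \<le> (\<Sum>k\<le>n. (\<Sum>i=p..<p+k. X i \<omega>)\<^sup>2)" for \<omega>
  proof -
    obtain k where k: "k \<le> n" "\<bar>m \<omega>\<bar> = \<bar>\<Sum>i=p..<p+k. X i \<omega>\<bar>" using att by blast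
    then have "(m \<omega>)\<^sup>2 = (\<Sum>i=p..<p+k. X i \<omega>)\<^sup>2" by (metis power2_abs)
    also have "\<dots> \<le> (\<Sum>k\<le>n. (\<Sum>i=p..<p+k. X i \<omega>)\<^sup>2)"
      using k by (intro member_le_sum) auto
    finally show ?thesis .
  qed
  then show "AE \<omega> in M. norm ((m \<omega>)\<^sup>2) \<le> norm (\<Sum>k\<le>n. (\<Sum>i=p..<p+k. X i \<omega>)\<^sup>2)"
    by (intro AE_I2) (simp add: sum_nonneg)
qed (use m in simp)

lemma expectation_partial_sum_square:
  "k \<le> n \<Longrightarrow> expectation (\<lambda>\<omega>. (\<Sum>i=p..<p+k. X i \<omega>)\<^sup>2) = (\<Sum>i=p..<p+k. expectation (\<lambda>\<omega>. (X i \<omega>)\<^sup>2))"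
proof (induction k)
  case (Suc k)
  then have pk: "p + k \<in> {p..<p+n}" by auto
  let ?G = "\<lambda>x :: nat \<Rightarrow> real. \<Sum>i=p..<p+k. x i"
  have eq: "?G (\<lambda>i\<in>{p..<p+k}. X i \<omega>) = (\<Sum>i=p..<p+k. X i \<omega>)" for \<omega> by simp
  have int: "integrable M (\<lambda>\<omega>. \<Sum>i=p..<p+k. X i \<omega>)"
    using Suc by (intro Bochner_Integration.integrable_sum increment_integrable) auto
  note cross = centred_increment_uncorrelated_with_past[OF indep, of "{p..<p+k}" "p+k" ?G,
      unfolded eq, OF _ pk _ _ int increment_integrable[OF pk] centred[OF pk]]
  have G: "?G \<in> borel_measurable (PiM {p..<p+k} (\<lambda>_. borel))" by measurable
  have "(\<lambda>\<omega>. (\<Sum>i=p..<p+Suc k. X i \<omega>)\<^sup>2) =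
      (\<lambda>\<omega>. (\<Sum>i=p..<p+k. X i \<omega>)\<^sup>2 + 2 * ((\<Sum>i=p..<p+k. X i \<omega>) * X (p+k) \<omega>) + (X (p+k) \<omega>)\<^sup>2)"
    by (simp add: power2_sum algebra_simps)
  then show ?case
    using Suc pk cross G partial_sum_square_integrable[of k] square_int[OF pk] by auto
qed (simp add: prob_space)

text \<open>
  Take expectations in the pathwise inequality: the running maximum up to step \<open>k\<close> is a function of
  the first \<open>k\<close> increments, so the correction terms have mean \<open>0\<close>.
\<close>

lemma expectation_running_max_square_le:
  defines "m \<equiv> \<lambda>k \<omega>. MAX j\<in>{..k}. \<Sum>i=p..<p+j. X i \<omega>"
  shows "integrable M (\<lambda>\<omega>. (m n \<omega>)\<^sup>2)"
    and "expectation (\<lambda>\<omega>. (m n \<omega>)\<^sup>2) \<le> 4 * (\<Sum>i=p..<p+n. expectation (\<lambda>\<omega>. (X i \<omega>)\<^sup>2))"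
proof -
  have m_measurable: "m k \<in> borel_measurable M" if "k \<le> n" for k
    unfolding m_def using that by (intro borel_measurable_Max partial_sum_measurable) auto
  have sq: "integrable M (\<lambda>\<omega>. (m k \<omega>)\<^sup>2)" if k: "k \<le> n" for k
  proof (rule partial_sum_max_square_integrable[OF m_measurable[OF k]])
    fix \<omega>
    have "m k \<omega> \<in> (\<lambda>j. \<Sum>i=p..<p+j. X i \<omega>) ` {..k}"
      unfolding m_def by (rule Max_in) auto
    then obtain j where "j \<le> k" "m k \<omega> = (\<Sum>i=p..<p+j. X i \<omega>)" by auto
    with k show "\<exists>j\<le>n. \<bar>m k \<omega>\<bar> = \<bar>\<Sum>i=p..<p+j. X i \<omega>\<bar>" by (intro exI[of _ j]) auto
  qed
  have cross: "integrable M (\<lambda>\<omega>. m k \<omega> * X (p+k) \<omega>)" "expectation (\<lambda>\<omega>. m k \<omega> * X (p+k) \<omega>) = 0"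
    if k: "k < n" for k
  proof -
    have pk: "p + k \<in> {p..<p+n}" using k by auto
    let ?G = "\<lambda>x :: nat \<Rightarrow> real. MAX j\<in>{..k}. \<Sum>i=p..<p+j. x i"
    have eq: "?G (\<lambda>i\<in>{p..<p+k}. X i \<omega>) = m k \<omega>" for \<omega>
      unfolding m_def by (intro arg_cong[where f=Max] image_cong refl sum.cong) auto
    have G: "?G \<in> borel_measurable (PiM {p..<p+k} (\<lambda>_. borel))"
      by (intro borel_measurable_Max borel_measurable_sum measurable_component_singleton) auto
    have int: "integrable M (m k)"
      using k by (intro square_integrable_imp_integrable[OF m_measurable sq]) auto
    show "integrable M (\<lambda>\<omega>. m k \<omega> * X (p+k) \<omega>)" "expectation (\<lambda>\<omega>. m k \<omega> * X (p+k) \<omega>) = 0"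
      using centred_increment_uncorrelated_with_past[OF indep, of "{p..<p+k}" "p+k" ?G,
        unfolded eq, OF _ pk _ G int increment_integrable[OF pk] centred[OF pk]] k by auto
  qed
  show "integrable M (\<lambda>\<omega>. (m n \<omega>)\<^sup>2)" by (rule sq) simp
  have int: "integrable M (\<lambda>\<omega>. (m n \<omega>)\<^sup>2 + 4 * (\<Sum>k<n. m k \<omega> * X (p+k) \<omega>))"
    by (intro Bochner_Integration.integrable_add integrable_mult_right sq Bochner_Integration.integrable_sum cross) auto
  have "expectation (\<lambda>\<omega>. (m n \<omega>)\<^sup>2) =
      expectation (\<lambda>\<omega>. (m n \<omega>)\<^sup>2 + 4 * (\<Sum>k<n. m k \<omega> * X (p+k) \<omega>))"
    using sq[of n] cross by (subst Bochner_Integration.integral_add)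
      (auto intro!: integrable_mult_right Bochner_Integration.integrable_sum)
  also have "\<dots> \<le> expectation (\<lambda>\<omega>. 4 * (\<Sum>i=p..<p+n. X i \<omega>)\<^sup>2)"
  proof (rule integral_mono[OF int])
    fix \<omega>
    show "(m n \<omega>)\<^sup>2 + 4 * (\<Sum>k<n. m k \<omega> * X (p+k) \<omega>) \<le> 4 * (\<Sum>i=p..<p+n. X i \<omega>)\<^sup>2"
      using running_max_square_le[of "\<lambda>j. \<Sum>i=p..<p+j. X i \<omega>" n] by (simp add: m_def)
  qed (use partial_sum_square_integrable in auto)
  also have "\<dots> = 4 * (\<Sum>i=p..<p+n. expectation (\<lambda>\<omega>. (X i \<omega>)\<^sup>2))"
    by (simp add: expectation_partial_sum_square)
  finally show "expectation (\<lambda>\<omega>. (m n \<omega>)\<^sup>2) \<le> 4 * (\<Sum>i=p..<p+n. expectation (\<lambda>\<omega>. (X i \<omega>)\<^sup>2))" .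
qed

lemma max_abs_sum_square_integrable: "integrable M (\<lambda>\<omega>. (max_abs_sum (\<lambda>i. X i \<omega>) p n)\<^sup>2)"
proof (rule partial_sum_max_square_integrable)
  show "(\<lambda>\<omega>. max_abs_sum (\<lambda>i. X i \<omega>) p n) \<in> borel_measurable M"
    by (intro max_abs_sum_measurable increment_measurable)
  show "\<exists>k\<le>n. \<bar>max_abs_sum (\<lambda>i. X i \<omega>) p n\<bar> = \<bar>\<Sum>i=p..<p+k. X i \<omega>\<bar>" for \<omega>
    using max_abs_sum_attained[of n "\<lambda>i. X i \<omega>" p] by (simp add: max_abs_sum_nonneg)
qed

end

text \<open>
  The maximum of the absolute values is a running maximum of the partial sums of \<open>X\<close> or of \<open>- X\<close>,
  which doubles the constant of the one-sided bound.
\<close>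

lemma expectation_max_abs_sum_square_le:
  fixes X :: "nat \<Rightarrow> 'a \<Rightarrow> real"
  assumes indep: "indep_vars (\<lambda>_. borel) X {p..<p+n}"
    and square_int: "\<And>i. i \<in> {p..<p+n} \<Longrightarrow> integrable M (\<lambda>\<omega>. (X i \<omega>)\<^sup>2)"
    and centred: "\<And>i. i \<in> {p..<p+n} \<Longrightarrow> expectation (X i) = 0"
  shows "expectation (\<lambda>\<omega>. (max_abs_sum (\<lambda>i. X i \<omega>) p n)\<^sup>2) \<le> 8 * (\<Sum>i=p..<p+n. expectation (\<lambda>\<omega>. (X i \<omega>)\<^sup>2))"
proof -
  have indep': "indep_vars (\<lambda>_. borel) (\<lambda>i \<omega>. - X i \<omega>) {p..<p+n}"
    by (rule indep_vars_compose2[OF indep]) simp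
  note pos = expectation_running_max_square_le[OF assms]
  note neg = expectation_running_max_square_le[OF indep', simplified, OF square_int centred]
  have "expectation (\<lambda>\<omega>. (max_abs_sum (\<lambda>i. X i \<omega>) p n)\<^sup>2) \<le>
     expectation (\<lambda>\<omega>. (MAX k\<in>{..n}. \<Sum>i=p..<p+k. X i \<omega>)\<^sup>2 + (MAX k\<in>{..n}. \<Sum>i=p..<p+k. - X i \<omega>)\<^sup>2)"
    by (intro integral_mono max_abs_sum_square_integrable[OF assms] Bochner_Integration.integrable_add
        pos(1) neg(1) max_abs_sum_square_le) auto
  also have "\<dots> \<le> 8 * (\<Sum>i=p..<p+n. expectation (\<lambda>\<omega>. (X i \<omega>)\<^sup>2))"
    using pos neg by simp
  finally show ?thesis .
qed

end

section \<open>Large values of the maximal partial sum\<close>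

text \<open>
  Integrated, this is the part of a second moment that comes from values above \<open>e\<close>.
\<close>

definition tail_square :: "real \<Rightarrow> real \<Rightarrow> real" where
  "tail_square e w = (if e < w then w\<^sup>2 else 0)"

lemma tail_square_nonneg: "0 \<le> tail_square e w"
  by (simp add: tail_square_def)

lemma tail_square_le_square: "tail_square e w \<le> w\<^sup>2"
  by (simp add: tail_square_def)

lemma tail_square_measurable [measurable]:
  assumes [measurable]: "f \<in> borel_measurable M"
  shows "(\<lambda>x. tail_square e (f x)) \<in> borel_measurable M"
  unfolding tail_square_def by measurable

lemma integrable_tail_square:
  assumes [measurable]: "f \<in> borel_measurable M" and "integrable M (\<lambda>x. (f x)\<^sup>2)"
  shows "integrable M (\<lambda>x. tail_square e (f x))"
  by (rule Bochner_Integration.integrable_bound[OF assms(2)])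
    (auto intro!: AE_I2 simp: tail_square_nonneg tail_square_le_square)

text \<open>
  The larger summand is at least half of the sum, hence it is above \<open>e / 2\<close> when the sum is above \<open>e\<close>,
  and its square is at least a quarter of the square of the sum.
\<close>

lemma tail_square_add_le:
  assumes "0 \<le> u" "0 \<le> v" "0 \<le> w" "w \<le> u + v"
  shows "tail_square e w \<le> 4 * tail_square (e / 2) u + 4 * tail_square (e / 2) v"
proof (cases "v \<le> u")
  case True
  then have "w\<^sup>2 \<le> (2 * u)\<^sup>2" using assms by (intro power_mono) auto
  then show ?thesis using True assms tail_square_nonneg[of "e/2" v]
    by (auto simp: tail_square_def)
next
  case False
  then have "w\<^sup>2 \<le> (2 * v)\<^sup>2" using assms by (intro power_mono) auto
  then show ?thesis using False assms tail_square_nonneg[of "e/2" u]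
    by (auto simp: tail_square_def)
qed

context prob_space begin

text \<open>
  Hoeffding's inequality for each partial sum and a union bound over the \<open>n\<close> of them. The union bound
  costs a factor \<open>n\<close>, which the exponential absorbs when \<open>e\<close> is of order \<open>n\<close>.
\<close>

lemma bounded_max_abs_sum_tail:
  fixes X :: "nat \<Rightarrow> 'a \<Rightarrow> real"
  assumes indep: "indep_vars (\<lambda>_. borel) X {p..<p+n}"
    and bounded: "\<And>i \<omega>. \<bar>X i \<omega>\<bar> \<le> K" and K: "0 < K" and e: "0 < e"
  shows "prob {\<omega> \<in> space M. e \<le> max_abs_sum (\<lambda>i. X i \<omega> - expectation (X i)) p n}
    \<le> 2 * real n * exp (- e\<^sup>2 / (2 * real n * K\<^sup>2))"
proof -
  let ?S = "\<lambda>k \<omega>. \<Sum>i=p..<p+k. X i \<omega> - expectation (X i)"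
  let ?B = "\<lambda>k. {\<omega> \<in> space M. e \<le> \<bar>?S k \<omega>\<bar>}"
  have increment_measurable: "i \<in> {p..<p+n} \<Longrightarrow> X i \<in> borel_measurable M" for i
    using indep by (auto simp: indep_vars_def)
  have B_sets: "?B k \<in> events" if "k \<in> {1..n}" for k
  proof -
    have [measurable]: "?S k \<in> borel_measurable M"
      using that by (intro borel_measurable_sum borel_measurable_diff increment_measurable) auto
    show ?thesis by measurable
  qed
  have B_prob: "prob (?B k) \<le> 2 * exp (- e\<^sup>2 / (2 * real n * K\<^sup>2))" if k: "k \<in> {1..n}" for k
  proof -
    interpret Hoeffding_ineq M "{p..<p+k}" X "\<lambda>_. - K" "\<lambda>_. K" "\<Sum>i=p..<p+k. expectation (X i)"
    proof unfold_locales
      show "indep_vars (\<lambda>_. borel) X {p..<p+k}"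
        by (rule indep_vars_subset[OF indep]) (use k in auto)
      show "AE \<omega> in M. X i \<omega> \<in> {- K..K}" for i
        using bounded[of i] by (intro AE_I2) (auto simp: abs_le_iff minus_le_iff)
    qed simp_all
    have kK: "(\<Sum>i=p..<p+k. (K - (- K))\<^sup>2) = 4 * real k * K\<^sup>2"
      by (simp add: power2_eq_square)
    have "prob (?B k) \<le> 2 * exp (- 2 * e\<^sup>2 / (4 * real k * K\<^sup>2))"
      using Hoeffding_ineq_abs_ge[of e] e k K unfolding kK by (simp add: sum_subtractf)
    also have "\<dots> \<le> 2 * exp (- e\<^sup>2 / (2 * real n * K\<^sup>2))"
    proof -
      have "e\<^sup>2 / (2 * real n * K\<^sup>2) \<le> e\<^sup>2 / (2 * real k * K\<^sup>2)"
        using k K by (intro divide_left_mono mult_right_mono) auto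
      then show ?thesis by simp
    qed
    finally show ?thesis .
  qed
  have "{\<omega> \<in> space M. e \<le> max_abs_sum (\<lambda>i. X i \<omega> - expectation (X i)) p n} \<subseteq> (\<Union>k\<in>{1..n}. ?B k)"
  proof safe
    fix \<omega> assume \<omega>: "\<omega> \<in> space M" "e \<le> max_abs_sum (\<lambda>i. X i \<omega> - expectation (X i)) p n"
    then obtain k where k: "k \<le> n" "e \<le> \<bar>?S k \<omega>\<bar>"
      using max_abs_sum_attained[of n "\<lambda>i. X i \<omega> - expectation (X i)" p] by auto
    with e have "k \<noteq> 0" by (cases "k = 0") auto
    with k \<omega> show "\<omega> \<in> (\<Union>k\<in>{1..n}. ?B k)" by (intro UN_I[of k]) auto
  qed
  then have "prob {\<omega> \<in> space M. e \<le> max_abs_sum (\<lambda>i. X i \<omega> - expectation (X i)) p n} \<le> prob (\<Union>k\<in>{1..n}. ?B k)"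
    using B_sets by (intro finite_measure_mono sets.finite_UN) auto
  also have "\<dots> \<le> (\<Sum>k\<in>{1..n}. prob (?B k))"
    using B_sets by (intro finite_measure_subadditive_finite) auto
  also have "\<dots> \<le> (\<Sum>k\<in>{1..n}. 2 * exp (- e\<^sup>2 / (2 * real n * K\<^sup>2)))"
    by (intro sum_mono B_prob)
  finally show ?thesis by simp
qed

context
  fixes X :: "nat \<Rightarrow> 'a \<Rightarrow> real" and Y :: "'a \<Rightarrow> real" and I :: "nat set"
  assumes indep: "indep_vars (\<lambda>_. borel) X I"
    and distr_X: "\<And>i. i \<in> I \<Longrightarrow> distr M borel (X i) = distr M borel Y"
    and Y_measurable [measurable]: "Y \<in> borel_measurable M"
    and Y_square: "integrable M (\<lambda>\<omega>. (Y \<omega>)\<^sup>2)"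
    and Y_mean: "expectation Y = 0"
begin

lemma iid_measurable: "i \<in> I \<Longrightarrow> X i \<in> borel_measurable M"
  using indep by (auto simp: indep_vars_def)

lemma iid_transfer:
  fixes g :: "real \<Rightarrow> real"
  assumes i: "i \<in> I" and [measurable]: "g \<in> borel_measurable borel"
  shows "expectation (\<lambda>\<omega>. g (X i \<omega>)) = expectation (\<lambda>\<omega>. g (Y \<omega>))"
    and "integrable M (\<lambda>\<omega>. g (X i \<omega>)) \<longleftrightarrow> integrable M (\<lambda>\<omega>. g (Y \<omega>))"
proof -
  note [measurable] = iid_measurable[OF i]
  show "expectation (\<lambda>\<omega>. g (X i \<omega>)) = expectation (\<lambda>\<omega>. g (Y \<omega>))"
    using integral_distr[of "X i" M borel g] integral_distr[of Y M borel g] distr_X[OF i] by simp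
  show "integrable M (\<lambda>\<omega>. g (X i \<omega>)) \<longleftrightarrow> integrable M (\<lambda>\<omega>. g (Y \<omega>))"
    using integrable_distr_eq[of "X i" M borel g] integrable_distr_eq[of Y M borel g] distr_X[OF i] by simp
qed

lemma iid_max_abs_sum_square:
  assumes "{p..<p+n} \<subseteq> I"
  shows "integrable M (\<lambda>\<omega>. (max_abs_sum (\<lambda>i. X i \<omega>) p n)\<^sup>2)"
    and "expectation (\<lambda>\<omega>. (max_abs_sum (\<lambda>i. X i \<omega>) p n)\<^sup>2) \<le> 8 * real n * expectation (\<lambda>\<omega>. (Y \<omega>)\<^sup>2)"
proof -
  have i: "i \<in> I" if "i \<in> {p..<p+n}" for i using that assms by blast
  have ind: "indep_vars (\<lambda>_. borel) X {p..<p+n}" by (rule indep_vars_subset[OF indep assms])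
  have sq: "integrable M (\<lambda>\<omega>. (X j \<omega>)\<^sup>2)" if "j \<in> {p..<p+n}" for j
    using iid_transfer(2)[OF i[OF that], of "\<lambda>x. x\<^sup>2"] Y_square by simp
  have mean: "expectation (X j) = 0" if "j \<in> {p..<p+n}" for j
    using iid_transfer(1)[OF i[OF that], of "\<lambda>x. x"] Y_mean by simp
  have eq: "expectation (\<lambda>\<omega>. (X j \<omega>)\<^sup>2) = expectation (\<lambda>\<omega>. (Y \<omega>)\<^sup>2)" if "j \<in> {p..<p+n}" for j
    using iid_transfer(1)[OF i[OF that], of "\<lambda>x. x\<^sup>2"] by simp
  show "integrable M (\<lambda>\<omega>. (max_abs_sum (\<lambda>i. X i \<omega>) p n)\<^sup>2)"
    by (rule max_abs_sum_square_integrable[OF ind sq mean])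
  show "expectation (\<lambda>\<omega>. (max_abs_sum (\<lambda>i. X i \<omega>) p n)\<^sup>2) \<le> 8 * real n * expectation (\<lambda>\<omega>. (Y \<omega>)\<^sup>2)"
    using expectation_max_abs_sum_square_le[OF ind sq mean] by (simp add: eq)
qed

text \<open>
  Each increment is split at the level \<open>K\<close> into a bounded part and a remainder, both recentred. The
  remainder enters through its second moment and the maximal inequality. The running maximum of the
  bounded parts is at most \<open>2 n K\<close> and rarely exceeds \<open>e / 2\<close>.
\<close>

lemma iid_tail_square_le:
  assumes sub: "{p..<p+n} \<subseteq> I" and K: "0 < K" and e: "0 < e"
  shows "expectation (\<lambda>\<omega>. tail_square e (max_abs_sum (\<lambda>i. X i \<omega>) p n))
    \<le> 32 * real n * expectation (\<lambda>\<omega>. (if \<bar>Y \<omega>\<bar> \<le> K then 0 else Y \<omega>)\<^sup>2)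
      + 32 * real n ^ 3 * K\<^sup>2 * exp (- e\<^sup>2 / (8 * real n * K\<^sup>2))"
proof -
  define low where "low x = (if \<bar>x\<bar> \<le> K then x else 0)" for x :: real
  define high where "high x = (if \<bar>x\<bar> \<le> K then 0 else x)" for x :: real
  \<comment> \<open>As \<open>Y\<close> is centred, the mean of its high part is \<open>- c\<close>.\<close>
  define c where "c = expectation (\<lambda>\<omega>. low (Y \<omega>))"
  have [measurable]: "low \<in> borel_measurable borel" "high \<in> borel_measurable borel"
    unfolding low_def high_def by measurable
  have low_high: "low x + high x = x" for x by (simp add: low_def high_def)
  have low_K: "\<bar>low x\<bar> \<le> K" for x using K by (simp add: low_def)
  have i: "i \<in> I" if "i \<in> {p..<p+n}" for i using that sub by blast
  have ind: "indep_vars (\<lambda>_. borel) X {p..<p+n}" by (rule indep_vars_subset[OF indep sub])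
  note [measurable] = iid_measurable[OF i]
  have Y_int: "integrable M Y" by (rule square_integrable_imp_integrable[OF Y_measurable Y_square])
  have low_int: "integrable M (\<lambda>\<omega>. low (Y \<omega>))"
    by (rule integrable_const_bound[of _ K]) (auto simp: low_K)
  have high_sq: "integrable M (\<lambda>\<omega>. (high (Y \<omega>))\<^sup>2)"
    by (rule Bochner_Integration.integrable_bound[OF Y_square]) (auto simp: high_def)
  have high_int: "integrable M (\<lambda>\<omega>. high (Y \<omega>))"
    by (rule square_integrable_imp_integrable[OF _ high_sq]) simp
  have high_mean: "expectation (\<lambda>\<omega>. high (Y \<omega>)) = - c"
    using Y_mean Bochner_Integration.integral_add[OF low_int high_int] by (simp add: low_high c_def)
  have low_mean: "expectation (\<lambda>\<omega>. low (X j \<omega>)) = c" if "j \<in> {p..<p+n}" for j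
    unfolding c_def by (rule iid_transfer(1)[OF i[OF that]]) simp

  let ?W = "\<lambda>\<omega>. max_abs_sum (\<lambda>i. X i \<omega>) p n"
  let ?L = "\<lambda>\<omega>. max_abs_sum (\<lambda>i. low (X i \<omega>) - c) p n"
  let ?H = "\<lambda>\<omega>. max_abs_sum (\<lambda>i. high (X i \<omega>) + c) p n"
  have meas: "?L \<in> borel_measurable M" "?H \<in> borel_measurable M" "?W \<in> borel_measurable M"
    by (intro max_abs_sum_measurable; simp)+
  have c_K: "\<bar>c\<bar> \<le> K"
  proof -
    have "\<bar>c\<bar> \<le> expectation (\<lambda>\<omega>. \<bar>low (Y \<omega>)\<bar>)" unfolding c_def by (rule integral_abs_bound)
    also have "\<dots> \<le> expectation (\<lambda>_. K)" using low_int by (intro integral_mono) (auto simp: low_K)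
    finally show ?thesis by (simp add: prob_space)
  qed
  have L_bound: "?L \<omega> \<le> 2 * real n * K" for \<omega>
  proof (rule max_abs_sum_leI)
    fix k assume k: "k \<le> n"
    have "\<bar>\<Sum>i=p..<p+k. low (X i \<omega>) - c\<bar> \<le> (\<Sum>i=p..<p+k. 2 * K)"
    proof (rule order_trans[OF sum_abs sum_mono])
      fix j show "\<bar>low (X j \<omega>) - c\<bar> \<le> 2 * K"
        using low_K[of "X j \<omega>"] c_K by linarith
    qed
    also have "\<dots> \<le> 2 * real n * K" using k K by simp
    finally show "\<bar>\<Sum>i=p..<p+k. low (X i \<omega>) - c\<bar> \<le> 2 * real n * K" .
  qed
  have L_sq: "(?L \<omega>)\<^sup>2 \<le> (2 * real n * K)\<^sup>2" for \<omega>
    by (intro power_mono L_bound max_abs_sum_nonneg)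
  have L_int: "integrable M (\<lambda>\<omega>. tail_square (e/2) (?L \<omega>))"
    using L_sq by (intro integrable_const_bound[of _ "(2 * real n * K)\<^sup>2"] tail_square_measurable meas AE_I2)
      (auto simp: tail_square_nonneg intro: order_trans[OF tail_square_le_square])
  let ?A = "{\<omega> \<in> space M. e / 2 \<le> ?L \<omega>}"
  have L_tail: "expectation (\<lambda>\<omega>. tail_square (e/2) (?L \<omega>)) \<le> 8 * real n ^ 3 * K\<^sup>2 * exp (- e\<^sup>2 / (8 * real n * K\<^sup>2))"
  proof -
    have A: "?A \<in> events" using meas(1) by measurable
    have "expectation (\<lambda>\<omega>. tail_square (e/2) (?L \<omega>)) \<le> expectation (\<lambda>\<omega>. (2 * real n * K)\<^sup>2 * indicator ?A \<omega>)"
      using L_sq A by (intro integral_mono L_int integrable_mult_right integrable_real_indicator)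
        (auto simp: tail_square_def indicator_def emeasure_eq_measure)
    also have "\<dots> = (2 * real n * K)\<^sup>2 * prob ?A" using A by simp
    also have "\<dots> \<le> (2 * real n * K)\<^sup>2 * (2 * real n * exp (- (e/2)\<^sup>2 / (2 * real n * K\<^sup>2)))"
    proof (rule mult_left_mono)
      have ind': "indep_vars (\<lambda>_. borel) (\<lambda>i \<omega>. low (X i \<omega>)) {p..<p+n}"
        by (rule indep_vars_compose2[OF ind]) simp
      have "?A = {\<omega> \<in> space M. e / 2 \<le> max_abs_sum (\<lambda>i. low (X i \<omega>) - expectation (\<lambda>\<omega>. low (X i \<omega>))) p n}"
        using low_mean by (auto cong: max_abs_sum_cong)
      then show "prob ?A \<le> 2 * real n * exp (- (e/2)\<^sup>2 / (2 * real n * K\<^sup>2))"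
        using bounded_max_abs_sum_tail[OF ind' low_K K, of "e/2"] e by simp
    qed simp
    also have "\<dots> = 8 * real n ^ 3 * K\<^sup>2 * exp (- e\<^sup>2 / (8 * real n * K\<^sup>2))"
      by (simp add: power_mult_distrib power_divide power2_eq_square power3_eq_cube)
    finally show ?thesis .
  qed
  have H: "integrable M (\<lambda>\<omega>. (?H \<omega>)\<^sup>2)"
    "expectation (\<lambda>\<omega>. (?H \<omega>)\<^sup>2) \<le> 8 * (real n * expectation (\<lambda>\<omega>. (high (Y \<omega>))\<^sup>2))"
  proof -
    have ind': "indep_vars (\<lambda>_. borel) (\<lambda>i \<omega>. high (X i \<omega>) + c) {p..<p+n}"
      by (rule indep_vars_compose2[OF ind]) simp
    have sq_Y: "integrable M (\<lambda>\<omega>. (high (Y \<omega>) + c)\<^sup>2)"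
      using high_sq by (intro integrable_square_add) auto
    have sq: "integrable M (\<lambda>\<omega>. (high (X j \<omega>) + c)\<^sup>2)" if "j \<in> {p..<p+n}" for j
      using iid_transfer(2)[OF i[OF that], of "\<lambda>x. (high x + c)\<^sup>2"] sq_Y by simp
    have mean: "expectation (\<lambda>\<omega>. high (X j \<omega>) + c) = 0" if "j \<in> {p..<p+n}" for j
      using iid_transfer(1)[OF i[OF that], of "\<lambda>x. high x + c"] high_int high_mean
      by (simp add: prob_space)
    have var: "expectation (\<lambda>\<omega>. (high (X j \<omega>) + c)\<^sup>2) \<le> expectation (\<lambda>\<omega>. (high (Y \<omega>))\<^sup>2)"
      if "j \<in> {p..<p+n}" for j
    proof -
      have "expectation (\<lambda>\<omega>. (high (X j \<omega>) + c)\<^sup>2) = expectation (\<lambda>\<omega>. (high (Y \<omega>) + c)\<^sup>2)"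
        using iid_transfer(1)[OF i[OF that], of "\<lambda>x. (high x + c)\<^sup>2"] by simp
      also have "\<dots> = expectation (\<lambda>\<omega>. (high (Y \<omega>))\<^sup>2 + 2 * c * high (Y \<omega>) + c\<^sup>2)"
        by (simp add: power2_sum algebra_simps)
      also have "\<dots> = expectation (\<lambda>\<omega>. (high (Y \<omega>))\<^sup>2) - c\<^sup>2"
        using high_sq high_int high_mean by (simp add: prob_space power2_eq_square)
      finally show ?thesis by simp
    qed
    show "integrable M (\<lambda>\<omega>. (?H \<omega>)\<^sup>2)"
      by (rule max_abs_sum_square_integrable[OF ind' sq mean])
    have "expectation (\<lambda>\<omega>. (?H \<omega>)\<^sup>2) \<le> 8 * (\<Sum>i=p..<p+n. expectation (\<lambda>\<omega>. (high (X i \<omega>) + c)\<^sup>2))"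
      by (rule expectation_max_abs_sum_square_le[OF ind' sq mean])
    also have "\<dots> \<le> 8 * (\<Sum>i=p..<p+n. expectation (\<lambda>\<omega>. (high (Y \<omega>))\<^sup>2))"
      by (intro mult_left_mono sum_mono var) auto
    finally show "expectation (\<lambda>\<omega>. (?H \<omega>)\<^sup>2) \<le> 8 * (real n * expectation (\<lambda>\<omega>. (high (Y \<omega>))\<^sup>2))" by simp
  qed
  have "expectation (\<lambda>\<omega>. tail_square e (?W \<omega>)) \<le>
      expectation (\<lambda>\<omega>. 4 * tail_square (e/2) (?L \<omega>) + 4 * (?H \<omega>)\<^sup>2)"
  proof (rule integral_mono)
    show "integrable M (\<lambda>\<omega>. tail_square e (?W \<omega>))"
      by (intro integrable_tail_square meas iid_max_abs_sum_square(1)[OF sub])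
    show "integrable M (\<lambda>\<omega>. 4 * tail_square (e/2) (?L \<omega>) + 4 * (?H \<omega>)\<^sup>2)"
      using L_int H(1) by simp
    fix \<omega>
    have "?W \<omega> \<le> ?L \<omega> + ?H \<omega>"
      using max_abs_sum_triangle[of "\<lambda>i. low (X i \<omega>) - c" "\<lambda>i. high (X i \<omega>) + c" p n]
      by (simp add: low_high)
    then have "tail_square e (?W \<omega>) \<le> 4 * tail_square (e/2) (?L \<omega>) + 4 * tail_square (e/2) (?H \<omega>)"
      by (intro tail_square_add_le max_abs_sum_nonneg)
    then show "tail_square e (?W \<omega>) \<le> 4 * tail_square (e/2) (?L \<omega>) + 4 * (?H \<omega>)\<^sup>2"
      using tail_square_le_square[of "e/2" "?H \<omega>"] by linarith
  qed
  also have "\<dots> = 4 * expectation (\<lambda>\<omega>. tail_square (e/2) (?L \<omega>)) + 4 * expectation (\<lambda>\<omega>. (?H \<omega>)\<^sup>2)"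
    using L_int H(1) by simp
  finally show ?thesis using L_tail H(2) unfolding high_def by linarith
qed

lemma truncated_second_moment_tendsto_0:
  assumes K: "filterlim K at_top sequentially"
  shows "(\<lambda>n. expectation (\<lambda>\<omega>. (if \<bar>Y \<omega>\<bar> \<le> K n then 0 else Y \<omega>)\<^sup>2)) \<longlonglongrightarrow> 0"
proof -
  have "(\<lambda>n. expectation (\<lambda>\<omega>. (if \<bar>Y \<omega>\<bar> \<le> K n then 0 else Y \<omega>)\<^sup>2)) \<longlonglongrightarrow> expectation (\<lambda>_. 0)"
  proof (rule integral_dominated_convergence[OF _ _ Y_square])
    show "AE \<omega> in M. (\<lambda>n. (if \<bar>Y \<omega>\<bar> \<le> K n then 0 else Y \<omega>)\<^sup>2) \<longlonglongrightarrow> 0"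
    proof (rule AE_I2)
      fix \<omega>
      have "\<forall>\<^sub>F n in sequentially. (if \<bar>Y \<omega>\<bar> \<le> K n then 0 else Y \<omega>)\<^sup>2 = 0"
        using K[unfolded filterlim_at_top, rule_format, of "\<bar>Y \<omega>\<bar>"] by eventually_elim simp
      then show "(\<lambda>n. (if \<bar>Y \<omega>\<bar> \<le> K n then 0 else Y \<omega>)\<^sup>2) \<longlonglongrightarrow> 0"
        by (rule tendsto_eventually)
    qed
  qed auto
  then show ?thesis by simp
qed

text \<open>
  The maximum of \<open>n\<close> partial sums is of order \<open>sqrt n\<close> in \<open>L\<^sup>2\<close>, so the normalised second moment
  is only bounded; the claim is that values of order \<open>n\<close> do not contribute to its limit. The truncation
  level must grow, to make the remainder negligible, but more slowly than \<open>sqrt n\<close>, for otherwise the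
  exponent in Hoeffding's inequality does not diverge.
\<close>

lemma iid_tail_square_negligible:
  assumes sub: "{p..} \<subseteq> I" and \<delta>: "0 < \<delta>"
  shows "(\<lambda>n. expectation (\<lambda>\<omega>. tail_square (\<delta> * real n) (max_abs_sum (\<lambda>i. X i \<omega>) p n)) / real n) \<longlonglongrightarrow> 0"
proof (rule tendsto_sandwich[of "\<lambda>_. 0"])
  let ?K = "\<lambda>n::nat. real n powr (1/4)"
  let ?bound = "\<lambda>n. 32 * expectation (\<lambda>\<omega>. (if \<bar>Y \<omega>\<bar> \<le> ?K n then 0 else Y \<omega>)\<^sup>2)
        + 32 * real n ^ 2 * (?K n)\<^sup>2 * exp (- (\<delta> * real n)\<^sup>2 / (8 * real n * (?K n)\<^sup>2))"
  have K: "filterlim ?K at_top sequentially" by real_asymp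
  have "(\<lambda>n. 32 * real n ^ 2 * (?K n)\<^sup>2 * exp (- (\<delta> * real n)\<^sup>2 / (8 * real n * (?K n)\<^sup>2))) \<longlonglongrightarrow> 0"
    using \<delta> by real_asymp
  from tendsto_add[OF tendsto_mult_left[OF truncated_second_moment_tendsto_0[OF K], of 32] this]
  show "?bound \<longlonglongrightarrow> 0" by simp
  show "\<forall>\<^sub>F n in sequentially. expectation (\<lambda>\<omega>. tail_square (\<delta> * real n) (max_abs_sum (\<lambda>i. X i \<omega>) p n)) / real n \<le> ?bound n"
  proof (rule eventually_sequentiallyI[of 1])
    fix n :: nat assume n: "1 \<le> n"
    have "{p..<p+n} \<subseteq> I" using sub by auto
    from iid_tail_square_le[OF this, of "?K n" "\<delta> * real n"] n \<delta>
    have "expectation (\<lambda>\<omega>. tail_square (\<delta> * real n) (max_abs_sum (\<lambda>i. X i \<omega>) p n)) \<le> real n * ?bound n"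
      by (simp add: algebra_simps power2_eq_square power3_eq_cube)
    then show "expectation (\<lambda>\<omega>. tail_square (\<delta> * real n) (max_abs_sum (\<lambda>i. X i \<omega>) p n)) / real n \<le> ?bound n"
      using n by (simp add: divide_le_eq mult.commute)
  qed
  show "\<forall>\<^sub>F n in sequentially. 0 \<le> expectation (\<lambda>\<omega>. tail_square (\<delta> * real n) (max_abs_sum (\<lambda>i. X i \<omega>) p n)) / real n"
    by (intro always_eventually allI divide_nonneg_nonneg integral_nonneg) (auto simp: tail_square_nonneg)
qed simp

end

end

section \<open>Chords of a path with drift\<close>

text \<open>
  The path \<open>S\<close> moves along \<open>u\<close> with speed \<open>m\<close>, up to the perturbation \<open>T\<close>. Outside the time
  windows in which \<open>a\<close> and \<open>b\<close> control \<open>T\<close>, the drift exceeds \<open>2 \<delta> n\<close> and beats the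
  perturbation. So \<open>S k \<bullet> u\<close> never falls below \<open>- a\<close> and never exceeds \<open>S n \<bullet> u + b\<close>, and every chord
  has a component of size at most \<open>N = S n \<bullet> u + a + b\<close> along \<open>u\<close>. A chord of transversal size at
  most \<open>2 w\<close> has length at most \<open>sqrt (N\<^sup>2 + 4 w\<^sup>2) \<le> N + 2 w\<^sup>2 / N\<close>, and \<open>N \<ge> m n / 2\<close>.
\<close>

lemma drift_diameter_le:
  fixes T :: "nat \<Rightarrow> 'a::real_inner" and u :: 'a and m :: real
  defines "S \<equiv> \<lambda>k. (real k * m) *\<^sub>R u + T k"
  assumes u: "norm u = 1" and m: "0 < m" and \<delta>: "0 < \<delta>" "\<delta> \<le> m / 2" and n: "0 < n"
    and T0: "T 0 = 0"
    and w: "\<And>k. k \<le> n \<Longrightarrow> norm (T k) \<le> w" "w \<le> \<delta> * real n"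
    and a: "\<And>k. k \<le> n \<Longrightarrow> real k * m \<le> 2 * \<delta> * real n \<Longrightarrow> norm (T k) \<le> a"
    and b: "\<And>k. k \<le> n \<Longrightarrow> real (n - k) * m \<le> 2 * \<delta> * real n \<Longrightarrow> norm (T n - T k) \<le> b"
    and ij: "i \<le> n" "j \<le> n"
  shows "norm (S j - S i) \<le> S n \<bullet> u + a + b + 4 * \<delta> / m * w"
proof -
  have uu: "u \<bullet> u = 1" using u by (simp add: norm_eq_1)
  have S_u: "S k \<bullet> u = real k * m + T k \<bullet> u" for k
    by (simp add: S_def inner_add_left uu)
  have inner_le: "\<bar>x \<bullet> u\<bar> \<le> norm x" for x
    using Cauchy_Schwarz_ineq2[of x u] u by simp
  have w0: "0 \<le> w" using w(1)[of 0] T0 by simp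
  have a0: "0 \<le> a" using a[of 0] T0 \<delta> by simp
  have b0: "0 \<le> b" using b[of n] \<delta> by simp
  have below: "- (S k \<bullet> u) \<le> a" if "k \<le> n" for k
  proof (cases "real k * m \<le> 2 * \<delta> * real n")
    case True
    have "0 \<le> real k * m" using m by simp
    then show ?thesis using a[OF that True] inner_le[of "T k"] S_u[of k] by linarith
  next
    case False
    have "0 < \<delta> * real n" using \<delta> n by simp
    then show ?thesis using w(1)[OF that] w(2) inner_le[of "T k"] S_u[of k] False a0 by linarith
  qed
  have over: "S k \<bullet> u - S n \<bullet> u \<le> b" if "k \<le> n" for k
  proof -
    have eq: "S k \<bullet> u - S n \<bullet> u = - (real (n - k) * m) - (T n - T k) \<bullet> u"
      using that by (simp add: S_u of_nat_diff inner_diff_left algebra_simps)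
    show ?thesis
    proof (cases "real (n - k) * m \<le> 2 * \<delta> * real n")
      case True
      have "0 \<le> real (n - k) * m" using m by simp
      then show ?thesis using b[OF that True] inner_le[of "T n - T k"] eq by linarith
    next
      case False
      have "norm (T n - T k) \<le> 2 * w"
        using norm_triangle_ineq4[of "T n" "T k"] w(1)[OF that] w(1)[of n] by simp
      then show ?thesis using w(2) inner_le[of "T n - T k"] eq False b0 by linarith
    qed
  qed
  define N where "N = S n \<bullet> u + a + b"
  define \<tau> where "\<tau> = T j - T i"
  define c where "c = (real j - real i) * m"
  have S_diff: "S j - S i = c *\<^sub>R u + \<tau>"
    by (simp add: S_def \<tau>_def c_def algebra_simps)
  have x: "\<bar>c + \<tau> \<bullet> u\<bar> \<le> N"
  proof -
    have "c + \<tau> \<bullet> u = S j \<bullet> u - S i \<bullet> u"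
      by (simp add: S_u c_def \<tau>_def inner_diff_left algebra_simps)
    then show ?thesis
      using below[OF ij(1)] below[OF ij(2)] over[OF ij(1)] over[OF ij(2)] unfolding N_def by linarith
  qed
  have \<tau>: "norm \<tau> \<le> 2 * w"
    unfolding \<tau>_def using norm_triangle_ineq4[of "T j" "T i"] w(1)[OF ij(1)] w(1)[OF ij(2)] by simp
  have N: "m * real n / 2 \<le> N"
  proof -
    have "\<delta> * real n \<le> m / 2 * real n" using \<delta> by (intro mult_right_mono) auto
    moreover have "- w \<le> T n \<bullet> u" using inner_le[of "T n"] w(1)[of n] by simp
    ultimately show ?thesis unfolding N_def S_u using a0 b0 w(2) by (simp add: algebra_simps)
  qed
  have mn: "0 < m * real n" using m n by simp
  have N0: "0 < N" using N mn by linarith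
  \<comment> \<open>Pythagoras: the component of \<open>\<tau>\<close> orthogonal to \<open>u\<close> is at most as long as \<open>\<tau>\<close>.\<close>
  have "(norm (S j - S i))\<^sup>2 = (c + \<tau> \<bullet> u)\<^sup>2 + (norm \<tau>)\<^sup>2 - (\<tau> \<bullet> u)\<^sup>2"
    unfolding S_diff power2_norm_eq_inner
    by (simp add: inner_add_left inner_add_right uu power2_eq_square algebra_simps inner_commute)
  also have "\<dots> \<le> N\<^sup>2 + (2 * w)\<^sup>2"
    using power_mono[OF x, of 2] power_mono[OF \<tau>, of 2] by (simp add: add_mono) (smt (verit) zero_le_power2)
  also have "\<dots> \<le> (N + 4 * \<delta> / m * w)\<^sup>2"
  proof -
    have "(2 * w)\<^sup>2 \<le> 4 * w * (\<delta> * real n)"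
      using mult_left_mono[OF w(2), of "4 * w"] w0 by (simp add: power2_eq_square)
    also have "\<dots> = 2 * (m * real n / 2) * (4 * \<delta> / m * w)" using m by simp
    also have "\<dots> \<le> 2 * N * (4 * \<delta> / m * w)"
      using N w0 m \<delta> by (intro mult_right_mono) auto
    also have "\<dots> \<le> 2 * N * (4 * \<delta> / m * w) + (4 * \<delta> / m * w)\<^sup>2" by simp
    finally show ?thesis by (simp add: power2_sum)
  qed
  finally have "norm (S j - S i) \<le> N + 4 * \<delta> / m * w"
    by (rule power2_le_imp_le) (use N0 w0 m \<delta> in auto)
  then show ?thesis by (simp add: N_def)
qed

text \<open>
  A bound in terms of \<open>w\<close> alone, for the case that the perturbation is large.
\<close>

lemma drift_diameter_le_crude:
  fixes T :: "nat \<Rightarrow> 'a::real_inner" and u :: 'a and m :: real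
  defines "S \<equiv> \<lambda>k. (real k * m) *\<^sub>R u + T k"
  assumes u: "norm u = 1" and m: "0 \<le> m"
    and w: "\<And>k. k \<le> n \<Longrightarrow> norm (T k) \<le> w"
    and ij: "i \<le> n" "j \<le> n"
  shows "norm (S j - S i) \<le> S n \<bullet> u + 3 * w"
proof -
  have uu: "u \<bullet> u = 1" using u by (simp add: norm_eq_1)
  have "S j - S i = ((real j - real i) * m) *\<^sub>R u + (T j - T i)"
    by (simp add: S_def algebra_simps)
  then have "norm (S j - S i) \<le> \<bar>real j - real i\<bar> * m + (norm (T j) + norm (T i))"
    using norm_triangle_ineq[of "((real j - real i) * m) *\<^sub>R u" "T j - T i"]
      norm_triangle_ineq4[of "T j" "T i"] u m by (simp add: abs_mult)
  moreover have "\<bar>real j - real i\<bar> * m \<le> real n * m"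
    using ij m by (intro mult_right_mono) auto
  moreover have "- w \<le> T n \<bullet> u"
    using Cauchy_Schwarz_ineq2[of "T n" u] u w[of n] by simp
  ultimately show ?thesis
    using w[OF ij(1)] w[OF ij(2)] by (simp add: S_def inner_add_left uu)
qed

text \<open>
  An upper bound for the largest norm of a partial sum; being a sum over coordinates, it inherits
  its moment bounds from the real case.
\<close>

definition coord_max_sum :: "(nat \<Rightarrow> real ^ 'd) \<Rightarrow> nat \<Rightarrow> nat \<Rightarrow> real" where
  "coord_max_sum v p n = (\<Sum>c\<in>UNIV. max_abs_sum (\<lambda>i. v i $ c) p n)"

lemma norm_sum_le_coord_max_sum:
  assumes "k \<le> n"
  shows "norm (sum v {p..<p+k}) \<le> coord_max_sum v p n"
proof -
  have "norm (sum v {p..<p+k}) \<le> (\<Sum>c\<in>UNIV. \<bar>sum v {p..<p+k} $ c\<bar>)"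
    by (rule norm_le_l1_cart)
  also have "\<dots> \<le> coord_max_sum v p n"
    unfolding coord_max_sum_def using abs_sum_le_max_abs_sum[OF assms]
    by (intro sum_mono) (simp add: sum_component)
  finally show ?thesis .
qed

text \<open>
  The two bounds on chords in squared form. Here \<open>L\<close> is the number of steps that the drift takes to
  cover the distance \<open>2 \<delta> n\<close>. The tail term takes over when the deviation exceeds \<open>\<delta> n\<close>.
\<close>

lemma drift_diameter_square_le:
  fixes v :: "nat \<Rightarrow> real ^ 'd" and u :: "real ^ 'd" and m :: real
  defines "S \<equiv> \<lambda>k. (real k * m) *\<^sub>R u + sum v {1..<1+k}"
  defines "w \<equiv> coord_max_sum v 1"
  assumes u: "norm u = 1" and m: "0 < m" and \<delta>: "0 < \<delta>" "\<delta> \<le> m / 2" and n: "0 < n"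
  defines "L \<equiv> nat \<lfloor>2 * \<delta> * real n / m\<rfloor>"
  shows "(diameter (S ` {0..n}) - S n \<bullet> u)\<^sup>2 \<le>
    3 * (w L)\<^sup>2 + 12 * (coord_max_sum v (Suc (n - L)) L)\<^sup>2
      + 48 * (\<delta> / m)\<^sup>2 * (w n)\<^sup>2 + 9 * tail_square (\<delta> * real n) (w n)"
    and "(diameter (S ` {0..n}) - S n \<bullet> u)\<^sup>2 \<le> 9 * (w n)\<^sup>2"
proof -
  let ?T = "\<lambda>k. sum v {1..<1+k}"
  let ?x = "diameter (S ` {0..n}) - S n \<bullet> u"
  have L_iff: "k \<le> L \<longleftrightarrow> real k * m \<le> 2 * \<delta> * real n" for k
    unfolding L_def using m \<delta> by (simp add: le_nat_floor le_nat_iff le_floor_iff pos_le_divide_eq)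
  have Ln: "L \<le> n"
  proof -
    have "real L * m \<le> 2 * \<delta> * real n" using L_iff[of L] by simp
    also have "\<dots> \<le> real n * m" using \<delta> n by (simp add: mult.commute)
    finally show ?thesis using m by simp
  qed
  have T_le: "norm (?T k) \<le> w l" if "k \<le> l" for k l
    unfolding w_def by (rule norm_sum_le_coord_max_sum[OF that])
  have x0: "0 \<le> ?x"
  proof -
    have "S n \<bullet> u \<le> norm (S n - S 0)"
      using Cauchy_Schwarz_ineq2[of "S n" u] u by (simp add: S_def)
    also have "\<dots> \<le> diameter (S ` {0..n})"
      using diameter_bounded_bound[of "S ` {0..n}" "S n" "S 0"]
      by (simp add: dist_norm finite_imp_bounded)
    finally show ?thesis by simp
  qed
  have diam_le: "?x \<le> B" if "\<And>i j. i \<le> n \<Longrightarrow> j \<le> n \<Longrightarrow> norm (S j - S i) \<le> S n \<bullet> u + B" for B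
  proof -
    have "diameter (S ` {0..n}) \<le> S n \<bullet> u + B"
      by (rule diameter_le) (use that in auto)
    then show ?thesis by simp
  qed
  have crude: "?x \<le> 3 * w n"
    unfolding S_def
    by (rule diam_le[unfolded S_def], rule drift_diameter_le_crude) (use u m T_le in auto)
  then show crude_sq: "?x\<^sup>2 \<le> 9 * (w n)\<^sup>2"
    using power_mono[OF crude x0, of 2] by (simp add: power_mult_distrib)
  let ?b = "coord_max_sum v (Suc (n - L)) L"
  show "?x\<^sup>2 \<le> 3 * (w L)\<^sup>2 + 12 * ?b\<^sup>2 + 48 * (\<delta> / m)\<^sup>2 * (w n)\<^sup>2 + 9 * tail_square (\<delta> * real n) (w n)"
  proof (cases "w n \<le> \<delta> * real n")
    case False
    then have "?x\<^sup>2 \<le> 9 * tail_square (\<delta> * real n) (w n)"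
      using crude_sq by (simp add: tail_square_def)
    moreover have "0 \<le> 3 * (w L)\<^sup>2 + 12 * ?b\<^sup>2 + 48 * (\<delta> / m)\<^sup>2 * (w n)\<^sup>2" by simp
    ultimately show ?thesis by linarith
  next
    case True
    \<comment> \<open>Compare both \<open>T n\<close> and \<open>T k\<close> with the value at the start of the last \<open>L\<close> steps.\<close>
    have last: "norm (?T n - ?T k) \<le> 2 * ?b" if "k \<le> n" "n - k \<le> L" for k
    proof -
      let ?p = "Suc (n - L)"
      have split: "?T (n - L + j) - ?T (n - L) = sum v {?p..<?p+j}" for j
        using sum.atLeastLessThan_concat[of 1 "Suc (n - L)" "Suc (n - L) + j" v] by (simp add: algebra_simps)
      have k: "n - L + (L - (n - k)) = k" "n - L + L = n" using that Ln by auto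
      have "?T n - ?T k = sum v {?p..<?p+L} - sum v {?p..<?p+(L - (n - k))}"
        using split[of L] split[of "L - (n - k)"] unfolding k by (simp add: algebra_simps)
      also have "norm \<dots> \<le> ?b + ?b"
        by (rule order_trans[OF norm_triangle_ineq4 add_mono]; rule norm_sum_le_coord_max_sum) simp_all
      finally show ?thesis by simp
    qed
    have "?x \<le> w L + 2 * ?b + 4 * \<delta> / m * w n"
      unfolding S_def
    proof (rule diam_le[unfolded S_def])
      fix i j assume "i \<le> n" "j \<le> n"
      then have "norm ((real j * m) *\<^sub>R u + ?T j - ((real i * m) *\<^sub>R u + ?T i))
          \<le> ((real n * m) *\<^sub>R u + ?T n) \<bullet> u + w L + 2 * ?b + 4 * \<delta> / m * w n"
      proof (intro drift_diameter_le[OF u m \<delta> n])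
        show "norm (?T k) \<le> w L" if "k \<le> n" "real k * m \<le> 2 * \<delta> * real n" for k
          using T_le[of k L] that L_iff[of k] by blast
        show "norm (?T n - ?T k) \<le> 2 * ?b" if "k \<le> n" "real (n - k) * m \<le> 2 * \<delta> * real n" for k
          using last[OF that(1)] that(2) L_iff[of "n - k"] by blast
      qed (use True T_le in auto)
      then show "norm ((real j * m) *\<^sub>R u + ?T j - ((real i * m) *\<^sub>R u + ?T i))
          \<le> ((real n * m) *\<^sub>R u + ?T n) \<bullet> u + (w L + 2 * ?b + 4 * \<delta> / m * w n)"
        by (simp only: add.assoc)
    qed
    then have "?x\<^sup>2 \<le> (w L + 2 * ?b + 4 * \<delta> / m * w n)\<^sup>2"
      by (rule power_mono) (rule x0)
    also have "\<dots> \<le> 3 * ((w L)\<^sup>2 + (2 * ?b)\<^sup>2 + (4 * \<delta> / m * w n)\<^sup>2)"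
    proof -
      have "(x + y + z)\<^sup>2 \<le> 3 * (x\<^sup>2 + y\<^sup>2 + z\<^sup>2)" for x y z :: real
        using sum_squares_ge_zero[of "x - y" "y - z"] zero_le_power2[of "x - z"]
        by (simp add: power2_eq_square algebra_simps)
      then show ?thesis .
    qed
    also have "\<dots> = 3 * (w L)\<^sup>2 + 12 * ?b\<^sup>2 + 48 * (\<delta> / m)\<^sup>2 * (w n)\<^sup>2"
      by (simp add: power_mult_distrib power_divide)
    finally show ?thesis using tail_square_nonneg[of "\<delta> * real n" "w n"] by linarith
  qed
qed

section \<open>Planar increments with independent identical distribution\<close>

context prob_space begin

context
  fixes V :: "nat \<Rightarrow> 'a \<Rightarrow> real ^ 2" and Y :: "'a \<Rightarrow> real ^ 2" and I :: "nat set"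
  assumes indep: "indep_vars (\<lambda>_. borel) V I"
    and distr_V: "\<And>i. i \<in> I \<Longrightarrow> distr M borel (V i) = distr M borel Y"
    and Y_measurable [measurable]: "Y \<in> borel_measurable M"
    and Y_square: "integrable M (\<lambda>\<omega>. (norm (Y \<omega>))\<^sup>2)"
    and Y_mean: "expectation Y = 0"
begin

lemma coordinate_iid:
  shows "indep_vars (\<lambda>_. borel) (\<lambda>i \<omega>. V i \<omega> $ c) I"
    and "\<And>i. i \<in> I \<Longrightarrow> distr M borel (\<lambda>\<omega>. V i \<omega> $ c) = distr M borel (\<lambda>\<omega>. Y \<omega> $ c)"
    and "(\<lambda>\<omega>. Y \<omega> $ c) \<in> borel_measurable M"
    and "integrable M (\<lambda>\<omega>. (Y \<omega> $ c)\<^sup>2)"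
    and "expectation (\<lambda>\<omega>. Y \<omega> $ c) = 0"
proof -
  show "indep_vars (\<lambda>_. borel) (\<lambda>i \<omega>. V i \<omega> $ c) I"
    by (rule indep_vars_compose2[OF indep]) simp
  show "distr M borel (\<lambda>\<omega>. V i \<omega> $ c) = distr M borel (\<lambda>\<omega>. Y \<omega> $ c)" if "i \<in> I" for i
  proof -
    have V: "V i \<in> borel_measurable M" using indep that by (auto simp: indep_vars_def)
    show ?thesis
      using distr_distr[of "\<lambda>x. x $ c" borel borel "V i" M] distr_distr[of "\<lambda>x. x $ c" borel borel Y M]
        distr_V[OF that] V by (simp add: comp_def)
  qed
  show Yc: "(\<lambda>\<omega>. Y \<omega> $ c) \<in> borel_measurable M"
    by (rule measurable_compose[OF Y_measurable borel_measurable_nth])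
  show "integrable M (\<lambda>\<omega>. (Y \<omega> $ c)\<^sup>2)"
    by (rule Bochner_Integration.integrable_bound[OF Y_square borel_measurable_power[OF Yc]])
      (auto intro!: AE_I2 simp: component_le_norm_cart simp flip: abs_le_square_iff)
  have "integrable M (\<lambda>\<omega>. norm (Y \<omega>))"
    by (rule square_integrable_imp_integrable[OF _ Y_square]) simp
  then have "integrable M Y" by (simp add: integrable_norm_iff)
  then show "expectation (\<lambda>\<omega>. Y \<omega> $ c) = 0"
    using integral_bounded_linear[OF bounded_linear_vec_nth, of M Y c] Y_mean by simp
qed

lemma iid_coord_max_sum_measurable:
  assumes "{p..<p+n} \<subseteq> I"
  shows "(\<lambda>\<omega>. coord_max_sum (\<lambda>i. V i \<omega>) p n) \<in> borel_measurable M"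
proof -
  have "(\<lambda>\<omega>. V i \<omega> $ c) \<in> borel_measurable M" if "i \<in> {p..<p+n}" for i c
    using coordinate_iid(1)[of c] that assms by (auto simp: indep_vars_def)
  then show ?thesis
    unfolding coord_max_sum_def by (intro borel_measurable_sum max_abs_sum_measurable) auto
qed

lemma iid_coord_max_sum_square:
  assumes "{p..<p+n} \<subseteq> I"
  shows "integrable M (\<lambda>\<omega>. (coord_max_sum (\<lambda>i. V i \<omega>) p n)\<^sup>2)"
    and "expectation (\<lambda>\<omega>. (coord_max_sum (\<lambda>i. V i \<omega>) p n)\<^sup>2) \<le> 16 * real n * expectation (\<lambda>\<omega>. (norm (Y \<omega>))\<^sup>2)"
proof -
  let ?m = "\<lambda>c \<omega>. max_abs_sum (\<lambda>i. V i \<omega> $ c) p n"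
  note sq = iid_max_abs_sum_square[OF coordinate_iid assms]
  have le: "(coord_max_sum (\<lambda>i. V i \<omega>) p n)\<^sup>2 \<le> 2 * (?m 1 \<omega>)\<^sup>2 + 2 * (?m 2 \<omega>)\<^sup>2" for \<omega>
    using sum_squares_bound[of "?m 1 \<omega>" "?m 2 \<omega>"] by (simp add: coord_max_sum_def sum_2 power2_sum)
  have int: "integrable M (\<lambda>\<omega>. 2 * (?m 1 \<omega>)\<^sup>2 + 2 * (?m 2 \<omega>)\<^sup>2)"
    using sq(1) by simp
  show sq_int: "integrable M (\<lambda>\<omega>. (coord_max_sum (\<lambda>i. V i \<omega>) p n)\<^sup>2)"
    by (rule Bochner_Integration.integrable_bound[OF int])
      (use iid_coord_max_sum_measurable[OF assms] le in \<open>auto intro!: AE_I2\<close>)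
  have "expectation (\<lambda>\<omega>. (coord_max_sum (\<lambda>i. V i \<omega>) p n)\<^sup>2)
      \<le> expectation (\<lambda>\<omega>. 2 * (?m 1 \<omega>)\<^sup>2 + 2 * (?m 2 \<omega>)\<^sup>2)"
    by (intro integral_mono sq_int int le)
  also have "\<dots> \<le> 16 * real n * (expectation (\<lambda>\<omega>. (Y \<omega> $ 1)\<^sup>2) + expectation (\<lambda>\<omega>. (Y \<omega> $ 2)\<^sup>2))"
    using sq(1) sq(2)[of 1] sq(2)[of 2] by (simp add: algebra_simps)
  also have "expectation (\<lambda>\<omega>. (Y \<omega> $ 1)\<^sup>2) + expectation (\<lambda>\<omega>. (Y \<omega> $ 2)\<^sup>2) = expectation (\<lambda>\<omega>. (norm (Y \<omega>))\<^sup>2)"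
    using coordinate_iid(4) by (simp add: norm_vec_def L2_set_def sum_2)
  finally show "expectation (\<lambda>\<omega>. (coord_max_sum (\<lambda>i. V i \<omega>) p n)\<^sup>2) \<le> 16 * real n * expectation (\<lambda>\<omega>. (norm (Y \<omega>))\<^sup>2)" .
qed

lemma iid_coord_tail_square_negligible:
  assumes sub: "{p..} \<subseteq> I" and \<delta>: "0 < \<delta>"
  shows "(\<lambda>n. expectation (\<lambda>\<omega>. tail_square (\<delta> * real n) (coord_max_sum (\<lambda>i. V i \<omega>) p n)) / real n) \<longlonglongrightarrow> 0"
proof (rule tendsto_sandwich[of "\<lambda>_. 0"])
  let ?m = "\<lambda>n c \<omega>. max_abs_sum (\<lambda>i. V i \<omega> $ c) p n"
  let ?E = "\<lambda>c n. expectation (\<lambda>\<omega>. tail_square (\<delta>/2 * real n) (?m n c \<omega>)) / real n"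
  have sub': "{p..<p+n} \<subseteq> I" for n using sub by auto
  have "?E c \<longlonglongrightarrow> 0" for c
    by (rule iid_tail_square_negligible[OF coordinate_iid sub half_gt_zero[OF \<delta>]])
  from tendsto_add[OF tendsto_mult_left[OF this[of 1], of 4] tendsto_mult_left[OF this[of 2], of 4]]
  show "(\<lambda>n. 4 * ?E 1 n + 4 * ?E 2 n) \<longlonglongrightarrow> 0" by simp
  show "\<forall>\<^sub>F n in sequentially. expectation (\<lambda>\<omega>. tail_square (\<delta> * real n) (coord_max_sum (\<lambda>i. V i \<omega>) p n)) / real n
      \<le> 4 * ?E 1 n + 4 * ?E 2 n"
  proof (intro always_eventually allI)
    fix n
    have meas: "?m n c \<in> borel_measurable M" for c
      using coordinate_iid(1)[of c] sub'[of n] by (intro max_abs_sum_measurable) (auto simp: indep_vars_def)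
    have int: "integrable M (\<lambda>\<omega>. tail_square (\<delta>/2 * real n) (?m n c \<omega>))" for c
      by (intro integrable_tail_square meas iid_max_abs_sum_square(1)[OF coordinate_iid sub'])
    have "expectation (\<lambda>\<omega>. tail_square (\<delta> * real n) (coord_max_sum (\<lambda>i. V i \<omega>) p n))
      \<le> expectation (\<lambda>\<omega>. 4 * tail_square (\<delta>/2 * real n) (?m n 1 \<omega>) + 4 * tail_square (\<delta>/2 * real n) (?m n 2 \<omega>))"
    proof (rule integral_mono)
      show "integrable M (\<lambda>\<omega>. tail_square (\<delta> * real n) (coord_max_sum (\<lambda>i. V i \<omega>) p n))"
        by (intro integrable_tail_square iid_coord_max_sum_measurable iid_coord_max_sum_square(1) sub')
      fix \<omega>
      show "tail_square (\<delta> * real n) (coord_max_sum (\<lambda>i. V i \<omega>) p n)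
          \<le> 4 * tail_square (\<delta>/2 * real n) (?m n 1 \<omega>) + 4 * tail_square (\<delta>/2 * real n) (?m n 2 \<omega>)"
        using tail_square_add_le[of "?m n 1 \<omega>" "?m n 2 \<omega>" "coord_max_sum (\<lambda>i. V i \<omega>) p n" "\<delta> * real n"]
        by (simp add: coord_max_sum_def sum_2 max_abs_sum_nonneg)
    qed (use int in simp)
    also have "\<dots> = 4 * expectation (\<lambda>\<omega>. tail_square (\<delta>/2 * real n) (?m n 1 \<omega>))
        + 4 * expectation (\<lambda>\<omega>. tail_square (\<delta>/2 * real n) (?m n 2 \<omega>))"
      using int by simp
    finally show "expectation (\<lambda>\<omega>. tail_square (\<delta> * real n) (coord_max_sum (\<lambda>i. V i \<omega>) p n)) / real n
        \<le> 4 * ?E 1 n + 4 * ?E 2 n"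
      by (simp add: divide_right_mono flip: add_divide_distrib)
  qed
  show "\<forall>\<^sub>F n in sequentially. 0 \<le> expectation (\<lambda>\<omega>. tail_square (\<delta> * real n) (coord_max_sum (\<lambda>i. V i \<omega>) p n)) / real n"
    by (intro always_eventually allI divide_nonneg_nonneg integral_nonneg) (auto simp: tail_square_nonneg)
qed simp

end

end

section \<open>The diameter of a planar random walk with drift\<close>

text \<open>
  This form of the diameter makes it measurable as a function of the points.
\<close>

lemma diameter_finite_image:
  assumes "finite K" "K \<noteq> {}"
  shows "diameter (f ` K) = (MAX p\<in>K \<times> K. dist (f (fst p)) (f (snd p)))"
proof -
  have "(\<lambda>(x, y). dist x y) ` (f ` K \<times> f ` K) = (\<lambda>p. dist (f (fst p)) (f (snd p))) ` (K \<times> K)"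
    by force
  then show ?thesis using assms by (simp add: diameter_def cSup_eq_Max)
qed

theorem theorem1p9:
  fixes M :: "'a measure"
    and Z :: "'a \<Rightarrow> real ^ 2"
    and Zs :: "nat \<Rightarrow> 'a \<Rightarrow> real ^ 2"
    and \<mu> \<mu>_hat :: "real ^ 2"
  assumes "prob_space M"
    and "iid_increments M Z Zs"
    and "integrable M (\<lambda>\<omega>. (norm (Z \<omega>))\<^sup>2)"
    and "\<mu> = (\<integral>\<omega>. Z \<omega> \<partial>M)"
    and "\<mu> \<noteq> 0"
    and "\<mu>_hat = (1 / norm \<mu>) *\<^sub>R \<mu>"
  shows "converges_in_L2 M
    (\<lambda>n \<omega>. real n powr (- 1 / 2) * \<bar>walk_diam Zs n \<omega> - walk Zs n \<omega> \<bullet> \<mu>_hat\<bar>)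
    (\<lambda>\<omega>. 0)"
proof -
  interpret prob_space M by fact
  define m where "m = norm \<mu>"
  define V where "V i \<omega> = Zs i \<omega> - \<mu>" for i \<omega>
  define Y where "Y \<omega> = Z \<omega> - \<mu>" for \<omega>
  define \<sigma>2 where "\<sigma>2 = expectation (\<lambda>\<omega>. (norm (Y \<omega>))\<^sup>2)"
  define x where "x n \<omega> = walk_diam Zs n \<omega> - walk Zs n \<omega> \<bullet> \<mu>_hat" for n \<omega>
  define W where "W p n \<omega> = coord_max_sum (\<lambda>i. V i \<omega>) p n" for p n \<omega>
  have m: "0 < m" and u: "norm \<mu>_hat = 1" and m_u: "m *\<^sub>R \<mu>_hat = \<mu>"
    using assms(5) by (simp_all add: m_def assms(6))
  have [measurable]: "Z \<in> borel_measurable M"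
    and Zs_indep: "indep_vars (\<lambda>_. borel) Zs {1..}"
    and Zs_distr: "\<And>i. i \<in> {1..} \<Longrightarrow> distr M borel (Zs i) = distr M borel Z"
    using assms(2) by (auto simp: iid_increments_def)
  have Zs_meas: "i \<ge> 1 \<Longrightarrow> Zs i \<in> borel_measurable M" for i
    using Zs_indep by (auto simp: indep_vars_def)
  have Z_int: "integrable M Z"
    using square_integrable_imp_integrable[of "\<lambda>\<omega>. norm (Z \<omega>)"] assms(3) by (simp add: integrable_norm_iff)
  have Y_meas: "Y \<in> borel_measurable M" unfolding Y_def by measurable
  have V_indep: "indep_vars (\<lambda>_. borel) V {1..}"
    unfolding V_def by (rule indep_vars_compose2[OF Zs_indep]) simp
  have V_distr: "distr M borel (V i) = distr M borel Y" if "i \<in> {1..}" for i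
    using distr_distr[of "\<lambda>z. z - \<mu>" borel borel "Zs i" M] distr_distr[of "\<lambda>z. z - \<mu>" borel borel Z M]
      Zs_distr[OF that] Zs_meas that by (simp add: comp_def V_def[abs_def] Y_def[abs_def])
  have Y_mean: "expectation Y = 0"
    unfolding Y_def using Z_int by (simp add: prob_space assms(4))
  have Y_sq: "integrable M (\<lambda>\<omega>. (norm (Y \<omega>))\<^sup>2)"
  proof (rule Bochner_Integration.integrable_bound)
    show "integrable M (\<lambda>\<omega>. 2 * (norm (Z \<omega>))\<^sup>2 + 2 * (norm \<mu>)\<^sup>2)" using assms(3) by simp
    show "AE \<omega> in M. norm ((norm (Y \<omega>))\<^sup>2) \<le> norm (2 * (norm (Z \<omega>))\<^sup>2 + 2 * (norm \<mu>)\<^sup>2)"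
    proof (rule AE_I2)
      fix \<omega>
      have "(norm (Y \<omega>))\<^sup>2 \<le> (norm (Z \<omega>) + norm \<mu>)\<^sup>2"
        unfolding Y_def by (intro power_mono norm_triangle_ineq4) simp
      then show "norm ((norm (Y \<omega>))\<^sup>2) \<le> norm (2 * (norm (Z \<omega>))\<^sup>2 + 2 * (norm \<mu>)\<^sup>2)"
        using sum_squares_bound[of "norm (Z \<omega>)" "norm \<mu>"] by (simp add: power2_sum)
    qed
  qed (use Y_meas in simp)
  note iid = V_indep V_distr Y_meas Y_sq Y_mean

  have W_sq_int: "integrable M (\<lambda>\<omega>. (W p n \<omega>)\<^sup>2)"
    and W_sq: "expectation (\<lambda>\<omega>. (W p n \<omega>)\<^sup>2) \<le> 16 * real n * \<sigma>2"
    and W_meas: "W p n \<in> borel_measurable M" if "1 \<le> p" for p n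
    unfolding W_def \<sigma>2_def
    by (rule iid_coord_max_sum_square[OF iid] iid_coord_max_sum_measurable[OF iid]; use that in auto)+

  have walk: "walk Zs k \<omega> = (real k * m) *\<^sub>R \<mu>_hat + sum (\<lambda>i. V i \<omega>) {1..<1+k}" for k \<omega>
    by (simp add: walk_def V_def sum_subtractf atLeastLessThanSuc_atLeastAtMost m_u sum_constant_scaleR
        del: sum_constant flip: scaleR_scaleR)
  \<comment> \<open>The crude bound does not depend on \<open>\<delta>\<close>, and \<open>m / 2\<close> is its largest admissible value.\<close>
  have x_sq: "(x n \<omega>)\<^sup>2 \<le> 9 * (W 1 n \<omega>)\<^sup>2" if "0 < n" for n \<omega>
    using drift_diameter_square_le(2)[OF u m, of "m/2" n "\<lambda>i. V i \<omega>"] m that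
    by (simp add: x_def walk_diam_def walk W_def)
  have walk_meas: "walk Zs k \<in> borel_measurable M" for k
    unfolding walk_def[abs_def] by (intro borel_measurable_sum Zs_meas) auto
  have x_meas: "x n \<in> borel_measurable M" for n
  proof -
    note [measurable] = walk_meas
    have "walk_diam Zs n \<in> borel_measurable M"
      unfolding walk_diam_def[abs_def]
      by (subst diameter_finite_image) (auto intro!: borel_measurable_Max)
    then show ?thesis unfolding x_def by measurable
  qed
  have x_int: "integrable M (\<lambda>\<omega>. (x n \<omega>)\<^sup>2)" if "0 < n" for n
    by (rule Bochner_Integration.integrable_bound[of M "\<lambda>\<omega>. 9 * (W 1 n \<omega>)\<^sup>2"])
      (use x_sq[OF that] x_meas W_sq_int[of 1] in auto)

  \<comment> \<open>The maximal inequality turns the three quadratic terms into multiples of \<open>\<delta>\<close>: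
    \<open>L \<le> 2 \<delta> n / m\<close> accounts for \<open>480\<close> and \<open>(\<delta> / m)\<^sup>2 \<le> \<delta> / (2 m)\<close> for \<open>384\<close>.\<close>
  have bound: "expectation (\<lambda>\<omega>. (x n \<omega>)\<^sup>2) / real n
      \<le> 864 * \<sigma>2 / m * \<delta> + 9 * (expectation (\<lambda>\<omega>. tail_square (\<delta> * real n) (W 1 n \<omega>)) / real n)"
    if \<delta>: "0 < \<delta>" "\<delta> \<le> m / 2" and n: "0 < n" for \<delta> n
  proof -
    define L where "L = nat \<lfloor>2 * \<delta> * real n / m\<rfloor>"
    let ?t = "\<lambda>\<omega>. tail_square (\<delta> * real n) (W 1 n \<omega>)"
    have t_int: "integrable M ?t" by (intro integrable_tail_square W_meas W_sq_int) simp_all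
    have \<sigma>2: "0 \<le> \<sigma>2" unfolding \<sigma>2_def by simp
    have "expectation (\<lambda>\<omega>. (x n \<omega>)\<^sup>2) \<le> expectation (\<lambda>\<omega>. 3 * (W 1 L \<omega>)\<^sup>2 + 12 * (W (Suc (n - L)) L \<omega>)\<^sup>2
        + 48 * (\<delta> / m)\<^sup>2 * (W 1 n \<omega>)\<^sup>2 + 9 * ?t \<omega>)"
    proof (rule integral_mono[OF x_int[OF n]])
      show "integrable M (\<lambda>\<omega>. 3 * (W 1 L \<omega>)\<^sup>2 + 12 * (W (Suc (n - L)) L \<omega>)\<^sup>2
        + 48 * (\<delta> / m)\<^sup>2 * (W 1 n \<omega>)\<^sup>2 + 9 * ?t \<omega>)"
        using W_sq_int t_int by simp
      show "(x n \<omega>)\<^sup>2 \<le> 3 * (W 1 L \<omega>)\<^sup>2 + 12 * (W (Suc (n - L)) L \<omega>)\<^sup>2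
        + 48 * (\<delta> / m)\<^sup>2 * (W 1 n \<omega>)\<^sup>2 + 9 * ?t \<omega>" for \<omega>
        using drift_diameter_square_le(1)[OF u m \<delta> n, of "\<lambda>i. V i \<omega>"]
        by (simp add: x_def walk_diam_def walk W_def L_def)
    qed
    also have "\<dots> = 3 * expectation (\<lambda>\<omega>. (W 1 L \<omega>)\<^sup>2) + 12 * expectation (\<lambda>\<omega>. (W (Suc (n - L)) L \<omega>)\<^sup>2)
        + 48 * (\<delta> / m)\<^sup>2 * expectation (\<lambda>\<omega>. (W 1 n \<omega>)\<^sup>2) + 9 * expectation ?t"
      using W_sq_int t_int by simp
    also have "\<dots> \<le> 3 * (16 * real L * \<sigma>2) + 12 * (16 * real L * \<sigma>2)
        + 48 * (\<delta> / m)\<^sup>2 * (16 * real n * \<sigma>2) + 9 * expectation ?t"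
      by (intro add_mono mult_left_mono W_sq) auto
    also have "\<dots> = 240 * \<sigma>2 * real L + 768 * real n * \<sigma>2 * (\<delta> / m)\<^sup>2 + 9 * expectation ?t"
      by simp
    also have "\<dots> \<le> 240 * \<sigma>2 * (2 * \<delta> * real n / m) + 768 * real n * \<sigma>2 * (\<delta> / m * (1 / 2)) + 9 * expectation ?t"
    proof -
      have "real L \<le> 2 * \<delta> * real n / m" unfolding L_def using \<delta> m by (simp add: of_nat_floor)
      moreover have "(\<delta> / m)\<^sup>2 \<le> \<delta> / m * (1 / 2)"
        unfolding power2_eq_square using \<delta> m by (intro mult_left_mono) (auto simp: field_simps)
      ultimately show ?thesis using \<sigma>2 by (intro add_mono mult_left_mono) auto
    qed
    also have "\<dots> = real n * (864 * \<sigma>2 / m * \<delta>) + 9 * expectation ?t"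
      by (simp add: algebra_simps)
    finally show ?thesis using n by (simp add: field_simps)
  qed

  have lim: "(\<lambda>n. expectation (\<lambda>\<omega>. (x n \<omega>)\<^sup>2) / real n) \<longlonglongrightarrow> 0"
  proof (rule order_tendstoI)
    fix e :: real assume "e < 0"
    then show "\<forall>\<^sub>F n in sequentially. e < expectation (\<lambda>\<omega>. (x n \<omega>)\<^sup>2) / real n"
      by (intro always_eventually allI) (simp add: order_less_le_trans)
  next
    fix e :: real assume e: "0 < e"
    have \<sigma>2: "0 \<le> \<sigma>2" unfolding \<sigma>2_def by simp
    \<comment> \<open>Adding \<open>1\<close> keeps the denominator positive when the increments are degenerate.\<close>
    define \<delta> where "\<delta> = min (m / 2) (e * m / (1728 * (\<sigma>2 + 1)))"
    have "0 < e * m / (1728 * (\<sigma>2 + 1))" using m e \<sigma>2 by simp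
    with m have \<delta>: "0 < \<delta>" "\<delta> \<le> m / 2"
      unfolding \<delta>_def by (simp, intro min.cobounded1)
    have small: "864 * \<sigma>2 / m * \<delta> \<le> e / 2"
    proof -
      have "864 * \<sigma>2 / m * \<delta> \<le> 864 * (\<sigma>2 + 1) / m * (e * m / (1728 * (\<sigma>2 + 1)))"
        using m \<sigma>2 \<delta> by (intro mult_mono divide_right_mono) (auto simp: \<delta>_def)
      also have "\<dots> = e / 2"
      proof -
        have cancel: "864 * s / m * (e * m / (1728 * s)) = e / 2" if "0 < s" for s
          using m that by (simp add: field_simps)
        show ?thesis by (rule cancel) (use \<sigma>2 in simp)
      qed
      finally show ?thesis .
    qed
    have "(\<lambda>n. expectation (\<lambda>\<omega>. tail_square (\<delta> * real n) (W 1 n \<omega>)) / real n) \<longlonglongrightarrow> 0"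
      unfolding W_def by (rule iid_coord_tail_square_negligible[OF iid]) (use \<delta> in auto)
    then have "\<forall>\<^sub>F n in sequentially. expectation (\<lambda>\<omega>. tail_square (\<delta> * real n) (W 1 n \<omega>)) / real n < e / 18"
      by (rule order_tendstoD) (use e in simp)
    with eventually_gt_at_top[of 0]
    show "\<forall>\<^sub>F n in sequentially. expectation (\<lambda>\<omega>. (x n \<omega>)\<^sup>2) / real n < e"
    proof eventually_elim
      case (elim n)
      then show ?case using bound[OF \<delta>, of n] small by linarith
    qed
  qed

  have scale: "(real n powr (- 1 / 2) * \<bar>y\<bar>)\<^sup>2 = y\<^sup>2 / real n" for n y
  proof (cases "n = 0")
    case False
    then have "(real n powr (- 1 / 2))\<^sup>2 = 1 / real n"
      by (simp add: power2_eq_square powr_minus_divide flip: powr_add)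
    then show ?thesis by (simp add: power_mult_distrib)
  qed simp
  have "integrable M (\<lambda>\<omega>. (x n \<omega>)\<^sup>2 / real n)" for n
    using x_int[of n] by (cases "n = 0") auto
  with lim x_meas show ?thesis
    unfolding converges_in_L2_def x_def[symmetric] diff_zero scale by simp
qed

end
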